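(* Let $-\pi/2<\alpha<\pi/2$ and $0\le\beta<1$, and let $f\in\mathcal{S}_{\alpha}(\beta)$. Then the Schwarzian derivative $S_f$ satisfies the following inequalities. (i) If $\sin^2\alpha+\beta^2\cos^2\alpha\le 1/4$, then $$|S_f(z)|\le \frac{2(1-\beta)\cos\alpha\,\{1-(1-|z|^2)\sqrt{\sin^2\alpha+\beta^2\cos^2\alpha}\}}{(1-|z|^2)^2\,(1-\sqrt{\sin^2\alpha+\beta^2\cos^2\alpha})}\quad\text{for all } z\in\mathbb{D}.$$ (ii) If $\sin^2\alpha+\beta^2\cos^2\alpha>1/4$, then for all $z\in\mathbb{D}$ $$|S_f(z)|\le \begin{cases} \dfrac{2(1-\beta)\cos\alpha\,\{1-(1-|z|^2)\sqrt{\sin^2\alpha+\beta^2\cos^2\alpha}\}}{(1-|z|^2)^2\,(1-\sqrt{\sin^2\alpha+\beta^2\cos^2\alpha})} & \text{for } |z|<\lambda,\\[4mm] \dfrac{2(1-\beta)\cos\alpha\,\sqrt{\sin^2\alpha+\beta^2\cos^2\alpha}}{(1-|z|)^2} & \text{for } |z|\ge\lambda, \end{cases}$$ where $$\lambda=\frac{1-\sqrt{\sin^2\alpha+\beta^2\cos^2\alpha}}{\sqrt{\sin^2\alpha+\beta^2\cos^2\alpha}}.$$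
   Context: $\mathbb{D}=\{z\in\mathbb{C}:|z|<1\}$ is the open unit disk. $\mathcal{A}$ is the class of analytic functions $f$ on $\mathbb{D}$ with $f(0)=0$ and $f'(0)=1$. For $-\pi/2<\alpha<\pi/2$ and $0\le\beta<1$, $\mathcal{S}_{\alpha}(\beta)$ is the class of $f\in\mathcal{A}$ that are locally univalent ($f'(z)\neq 0$ for all $z\in\mathbb{D}$, which is implicit in the following condition) and satisfy $$\operatorname{Re}\left\{e^{i\alpha}\left(1+\frac{zf''(z)}{f'(z)}\right)\right\}>\beta\cos\alpha\quad\text{for all } z\in\mathbb{D}.$$ The Schwarzian derivative of a locally univalent analytic function $f$ on $\mathbb{D}$ is $$S_f(z)=\left(\frac{f''(z)}{f'(z)}\right)'-\frac12\left(\frac{f''(z)}{f'(z)}\right)^2.$$ *)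

theory Defs
  imports "HOL-Complex_Analysis.Complex_Analysis"
begin

abbreviation unit_disk :: "complex set" where
  "unit_disk \<equiv> ball 0 1"

definition class_A :: "(complex \<Rightarrow> complex) set" where
  "class_A = {f. f holomorphic_on unit_disk \<and> f 0 = 0 \<and> deriv f 0 = 1}"

definition locally_univalent :: "(complex \<Rightarrow> complex) \<Rightarrow> bool" where
  "locally_univalent f \<longleftrightarrow> f holomorphic_on unit_disk \<and> (\<forall>z\<in>unit_disk. deriv f z \<noteq> 0)"

text \<open>
  Local univalence has to be required separately: since division by zero yields zero in HOL,
  the inequality on the real part would not exclude zeros of the derivative.
\<close>

definition class_S :: "real \<Rightarrow> real \<Rightarrow> (complex \<Rightarrow> complex) set" where
  "class_S \<alpha> \<beta> = {f \<in> class_A. locally_univalent f \<and>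
     (\<forall>z\<in>unit_disk.
        Re (exp (\<i> * of_real \<alpha>) * (1 + z * deriv (deriv f) z / deriv f z)) > \<beta> * cos \<alpha>)}"

definition schwarzian :: "(complex \<Rightarrow> complex) \<Rightarrow> complex \<Rightarrow> complex" where
  "schwarzian f z =
     deriv (\<lambda>w. deriv (deriv f) w / deriv f w) z - 1/2 * (deriv (deriv f) z / deriv f z)\<^sup>2"

end

theory Submission
  imports Defs
begin

text \<open>
  Put \<open>T = f'' / f'\<close>, \<open>C = 2 (1 - \<beta>) cos \<alpha>\<close> and \<open>c = C exp (- \<i> \<alpha>)\<close>. The defining inequality of the class says
  \<open>C / 2 + Re (exp (\<i> \<alpha>) z T(z)) > 0\<close>, which is exactly \<open>\<bar>z T\<bar> < \<bar>c + z T\<bar>\<close>. Hence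
  \<open>\<phi> = T / (c + z T)\<close> is holomorphic with \<open>\<bar>z \<phi>(z)\<bar> < 1\<close>, and Schwarz's lemma gives \<open>\<bar>\<phi>\<bar> \<le> 1\<close>.
  Solving for \<open>T = c \<phi> / (1 - z \<phi>)\<close> one finds
  \<open>S\<^sub>f = c (\<phi>' + (1 - c / 2) \<phi>\<^sup>2) / (1 - z \<phi>)\<^sup>2\<close>,
  where \<open>\<bar>1 - c/2\<bar>\<close> is the constant \<open>k = sqrt (sin\<^sup>2 \<alpha> + \<beta>\<^sup>2 cos\<^sup>2 \<alpha>)\<close>.

  By the Schwarz--Pick inequality \<open>\<bar>\<phi>'\<bar> \<le> (1 - t\<^sup>2) / (1 - r\<^sup>2)\<close> with \<open>t = \<bar>\<phi>(z)\<bar>\<close> and \<open>r = \<bar>z\<bar>\<close>, the Schwarzian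
  is thus at most \<open>C / (1 - r\<^sup>2)\<close> times \<open>h(t) = (1 - a t\<^sup>2) / (1 - r t)\<^sup>2\<close>, where \<open>a = 1 - k (1 - r\<^sup>2)\<close>.
  What remains is to maximise \<open>h\<close> over \<open>t \<in> [0, 1]\<close>. Its only critical point is \<open>t = r / a\<close>, with value
  \<open>a / (a - r\<^sup>2)\<close>; if \<open>r \<ge> a\<close>, which means \<open>k (1 + r) \<ge> 1\<close>, i.e. \<open>r \<ge> (1 - k) / k\<close>, the maximum is
  instead attained at the end point \<open>t = 1\<close>. These two values are the two bounds of the theorem. The identity for \<open>S\<^sub>f\<close> is
  \<open>riccati_of_quotient\<close>, its combination with \<open>Schwarz_Pick_deriv\<close> is \<open>norm_schwarzian_le\<close>, and the two
  maxima are \<open>quotient_le_critical_value\<close> and \<open>quotient_le_endpoint_value\<close>.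
\<close>

section \<open>The Schwarz--Pick inequality\<close>

lemma one_minus_cnj_mult_nonzero:
  fixes w z :: complex
  assumes "norm w < 1" "norm z < 1"
  shows "1 - cnj w * z \<noteq> 0"
proof -
  have "norm (cnj w * z) < 1"
    using norm_mult_less[of "cnj w" 1 z 1] assms by simp
  then show ?thesis by auto
qed

lemma Moebius_function_has_field_derivative:
  assumes "norm w < 1" "norm z < 1"
  shows "(Moebius_function 0 w has_field_derivative
           (1 - of_real ((norm w)\<^sup>2)) / (1 - cnj w * z)\<^sup>2) (at z)"
proof -
  have nz: "1 - cnj w * z \<noteq> 0"
    using assms by (rule one_minus_cnj_mult_nonzero)
  have sq: "of_real ((norm w)\<^sup>2) = w * cnj w"
    using complex_norm_square[of w] by simp
  have "((\<lambda>z. (z - w) / (1 - cnj w * z)) has_field_derivative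
           (1 - of_real ((norm w)\<^sup>2)) / (1 - cnj w * z)\<^sup>2) (at z)"
    unfolding sq using nz
    by (auto intro!: derivative_eq_intros simp: power2_eq_square algebra_simps)
  then show ?thesis
    by (simp add: Moebius_function_simple[abs_def])
qed

text \<open>
  Conjugating with disc automorphisms moves both \<open>a\<close> and \<open>\<phi> a\<close> to the origin, where the
  derivative part of Schwarz's lemma applies.
\<close>

lemma Schwarz_Pick_deriv_strict:
  assumes hol: "\<phi> holomorphic_on ball 0 1"
    and bd: "\<And>z. norm z < 1 \<Longrightarrow> norm (\<phi> z) < 1" and a: "norm a < 1"
  shows "norm (deriv \<phi> a) \<le> (1 - (norm (\<phi> a))\<^sup>2) / (1 - (norm a)\<^sup>2)"
proof -
  define M where "M = Moebius_function 0 (\<phi> a)"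
  define N where "N = Moebius_function 0 (- a)"
  have N0: "N 0 = a"
    by (simp add: N_def Moebius_function_of_zero)
  have Nbd: "norm (N z) < 1" if "norm z < 1" for z
    unfolding N_def using Moebius_function_norm_lt_1 a that by simp
  have Mbd: "norm (M z) < 1" if "norm z < 1" for z
    unfolding M_def using Moebius_function_norm_lt_1 bd[OF a] that by simp
  have Nhol: "N holomorphic_on ball 0 1"
    unfolding N_def using Moebius_function_holomorphic a by simp
  have Mhol: "M holomorphic_on ball 0 1"
    unfolding M_def using Moebius_function_holomorphic bd[OF a] by simp
  have "M \<circ> (\<phi> \<circ> N) holomorphic_on ball 0 1"
  proof (rule holomorphic_on_compose_gen[OF _ Mhol])
    show "\<phi> \<circ> N holomorphic_on ball 0 1"
      by (rule holomorphic_on_compose_gen[OF Nhol hol]) (use Nbd in auto)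
  qed (use Nbd bd in auto)
  moreover have "(M \<circ> (\<phi> \<circ> N)) 0 = 0"
    by (simp add: N0 M_def Moebius_function_eq_zero)
  moreover have "norm ((M \<circ> (\<phi> \<circ> N)) z) < 1" if "norm z < 1" for z
    using that by (auto intro!: Mbd bd Nbd)
  ultimately have le1: "norm (deriv (M \<circ> (\<phi> \<circ> N)) 0) \<le> 1"
    using Schwarz_Lemma(2)[where f = "M \<circ> (\<phi> \<circ> N)" and \<xi> = 0] by auto
  have pos: "0 < 1 - (norm (\<phi> a))\<^sup>2" "0 < 1 - (norm a)\<^sup>2"
    using bd[OF a] a by (simp_all add: power_less_one_iff abs_square_less_1)
  have dN: "(N has_field_derivative of_real (1 - (norm a)\<^sup>2)) (at 0)"
    unfolding N_def using Moebius_function_has_field_derivative[of "- a" 0] a by simp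
  have dphi: "(\<phi> has_field_derivative deriv \<phi> a) (at (N 0))"
    unfolding N0 using hol a by (intro holomorphic_derivI[where S = "ball 0 1"]) auto
  have "(M has_field_derivative
          (1 - of_real ((norm (\<phi> a))\<^sup>2)) / (1 - cnj (\<phi> a) * \<phi> a)\<^sup>2) (at (\<phi> a))"
    unfolding M_def by (rule Moebius_function_has_field_derivative) (use bd[OF a] in auto)
  moreover have "cnj (\<phi> a) * \<phi> a = of_real ((norm (\<phi> a))\<^sup>2)"
    using complex_norm_square[of "\<phi> a"] by (simp add: mult.commute)
  ultimately have dM: "(M has_field_derivative
          of_real (1 - (norm (\<phi> a))\<^sup>2) / (of_real (1 - (norm (\<phi> a))\<^sup>2))\<^sup>2) (at ((\<phi> \<circ> N) 0))"
    by (simp add: N0)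
  have "deriv (M \<circ> (\<phi> \<circ> N)) 0 =
      of_real (1 - (norm (\<phi> a))\<^sup>2) / (of_real (1 - (norm (\<phi> a))\<^sup>2))\<^sup>2
      * (deriv \<phi> a * of_real (1 - (norm a)\<^sup>2))"
    by (intro DERIV_imp_deriv DERIV_chain dM dphi dN)
  then have "norm (deriv (M \<circ> (\<phi> \<circ> N)) 0) =
      (1 - (norm (\<phi> a))\<^sup>2) / (1 - (norm (\<phi> a))\<^sup>2)\<^sup>2 * (norm (deriv \<phi> a) * (1 - (norm a)\<^sup>2))"
    using pos by (simp only: norm_mult norm_divide norm_power norm_of_real abs_of_pos)
  also have "\<dots> = norm (deriv \<phi> a) * (1 - (norm a)\<^sup>2) / (1 - (norm (\<phi> a))\<^sup>2)"
    using pos by (simp add: power2_eq_square)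
  finally have "norm (deriv \<phi> a) * (1 - (norm a)\<^sup>2) / (1 - (norm (\<phi> a))\<^sup>2) \<le> 1"
    using le1 by linarith
  then show ?thesis
    using pos by (simp only: pos_divide_le_eq pos_le_divide_eq mult_1)
qed

text \<open>
  A map into the closed disc that touches the unit circle is constant by the maximum principle,
  so it satisfies the inequality trivially.
\<close>

lemma Schwarz_Pick_deriv:
  assumes hol: "\<phi> holomorphic_on ball 0 1"
    and bd: "\<And>z. norm z < 1 \<Longrightarrow> norm (\<phi> z) \<le> 1" and a: "norm a < 1"
  shows "norm (deriv \<phi> a) \<le> (1 - (norm (\<phi> a))\<^sup>2) / (1 - (norm a)\<^sup>2)"
proof (cases "\<exists>b. norm b < 1 \<and> norm (\<phi> b) = 1")
  case True
  then obtain b where b: "norm b < 1" "norm (\<phi> b) = 1" by blast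
  have "\<phi> constant_on ball 0 1"
    by (rule maximum_modulus_principle[OF hol, where U = "ball 0 1" and \<xi> = b]) (use b bd in auto)
  then obtain d where d: "\<And>z. z \<in> ball 0 1 \<Longrightarrow> \<phi> z = d"
    by (auto simp: constant_on_def)
  have "(\<phi> has_field_derivative 0) (at a)"
    by (rule has_field_derivative_transform_within_open[where f = "\<lambda>_. d" and S = "ball 0 1"])
       (use d a in auto)
  then have "deriv \<phi> a = 0"
    by (rule DERIV_imp_deriv)
  then show ?thesis
    using bd[OF a] a by (simp add: abs_square_le_1)
next
  case False
  then show ?thesis
    using Schwarz_Pick_deriv_strict[OF hol _ a] bd by (metis order_le_less)
qed

text \<open>
  This is Schwarz's lemma for \<open>z \<phi>(z)\<close>; dividing by \<open>z\<close> fails at the origin, where the value of \<open>\<phi>\<close> is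
  the derivative of \<open>z \<phi>(z)\<close>.
\<close>

lemma norm_le_1_if_norm_ident_mult_less_1:
  assumes hol: "\<phi> holomorphic_on ball 0 1"
    and bd: "\<And>z. norm z < 1 \<Longrightarrow> norm (z * \<phi> z) < 1" and z: "norm z < 1"
  shows "norm (\<phi> z) \<le> 1"
proof -
  have h: "(\<lambda>z. z * \<phi> z) holomorphic_on ball 0 1"
    by (intro holomorphic_intros hol)
  show ?thesis
  proof (cases "z = 0")
    case True
    have "(\<phi> has_field_derivative deriv \<phi> 0) (at 0)"
      using hol by (intro holomorphic_derivI[where S = "ball 0 1"]) auto
    then have "((\<lambda>z. z * \<phi> z) has_field_derivative \<phi> 0) (at 0)"
      by (auto intro!: derivative_eq_intros)
    then have "deriv (\<lambda>z. z * \<phi> z) 0 = \<phi> 0"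
      by (rule DERIV_imp_deriv)
    then show ?thesis
      using Schwarz_Lemma(2)[OF h _ bd, of 0] True by simp
  next
    case False
    then show ?thesis
      using Schwarz_Lemma(1)[OF h _ bd z] by (simp add: norm_mult)
  qed
qed

section \<open>The Schwarzian in terms of a bounded function\<close>

lemma norm_less_norm_add_iff:
  fixes c u :: complex
  shows "norm u < norm (c + u) \<longleftrightarrow> 0 < (norm c)\<^sup>2 + 2 * Re (cnj c * u)"
proof -
  have "norm u < norm (c + u) \<longleftrightarrow> (norm u)\<^sup>2 < (norm (c + u))\<^sup>2"
    by (simp add: abs_le_square_iff[symmetric] flip: not_le)
  also have "\<dots> \<longleftrightarrow> 0 < (norm c)\<^sup>2 + 2 * Re (cnj c * u)"
    unfolding cmod_power2 by (simp add: power2_eq_square algebra_simps)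
  finally show ?thesis .
qed

text \<open>
  With \<open>T = f'' / f'\<close> the left-hand side is the Schwarzian. In \<open>\<phi>' + (1 - c / 2) \<phi>\<^sup>2\<close>, written over the
  denominator \<open>(c + z T)\<^sup>2\<close>, the terms \<open>z T T'\<close> cancel and \<open>c (T' - T\<^sup>2 / 2)\<close> remains;
  since \<open>1 - z \<phi> = c / (c + z T)\<close>, division by \<open>(1 - z \<phi>)\<^sup>2\<close> removes that denominator.
\<close>

lemma riccati_of_quotient:
  fixes T :: "complex \<Rightarrow> complex"
  assumes dT: "(T has_field_derivative T') (at z)"
    and nz: "c + z * T z \<noteq> 0" and c: "c \<noteq> 0"
  defines "\<phi> \<equiv> \<lambda>z. T z / (c + z * T z)"
  shows "T' - 1/2 * (T z)\<^sup>2 = c * (deriv \<phi> z + (1 - c / 2) * (\<phi> z)\<^sup>2) / (1 - z * \<phi> z)\<^sup>2"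
proof -
  have "(\<phi> has_field_derivative (T' * (c + z * T z) - T z * (T z + z * T')) / (c + z * T z)\<^sup>2) (at z)"
    unfolding \<phi>_def using nz
    by (auto intro!: derivative_eq_intros dT simp: power2_eq_square algebra_simps)
  then have d: "deriv \<phi> z = (T' * (c + z * T z) - T z * (T z + z * T')) / (c + z * T z)\<^sup>2"
    by (rule DERIV_imp_deriv)
  have w: "1 - z * \<phi> z = c / (c + z * T z)"
    using nz by (simp add: \<phi>_def field_simps)
  have "deriv \<phi> z + (1 - c / 2) * (\<phi> z)\<^sup>2 = c * (T' - 1/2 * (T z)\<^sup>2) / (c + z * T z)\<^sup>2"
    unfolding d unfolding \<phi>_def power_divide times_divide_eq_right add_divide_distrib[symmetric]
    by (rule arg_cong2[where f = "(/)"]) (simp_all add: power2_eq_square algebra_simps)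
  then show ?thesis
    unfolding w using nz c by (simp add: power_divide power2_eq_square)
qed

lemma norm_class_S_constant:
  "norm (1 - of_real ((1 - \<beta>) * cos \<alpha>) * cis (- \<alpha>)) = sqrt ((sin \<alpha>)\<^sup>2 + \<beta>\<^sup>2 * (cos \<alpha>)\<^sup>2)"
proof -
  have "(1 - (1 - \<beta>) * cos \<alpha> * cos \<alpha>)\<^sup>2 + ((1 - \<beta>) * cos \<alpha> * sin \<alpha>)\<^sup>2
      = 1 - 2 * (1 - \<beta>) * (cos \<alpha>)\<^sup>2 + (1 - \<beta>)\<^sup>2 * (cos \<alpha>)\<^sup>2 * ((sin \<alpha>)\<^sup>2 + (cos \<alpha>)\<^sup>2)"
    by (simp only: power2_eq_square) algebra
  also have "\<dots> = ((sin \<alpha>)\<^sup>2 + (cos \<alpha>)\<^sup>2) - 2 * (1 - \<beta>) * (cos \<alpha>)\<^sup>2 + (1 - \<beta>)\<^sup>2 * (cos \<alpha>)\<^sup>2"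
    by simp
  also have "\<dots> = (sin \<alpha>)\<^sup>2 + \<beta>\<^sup>2 * (cos \<alpha>)\<^sup>2"
    by (simp only: power2_eq_square) algebra
  finally show ?thesis
    by (simp add: cmod_def)
qed

text \<open>
  The modulus \<open>t\<close> of the bounded function at \<open>z\<close> is all that the estimate retains of \<open>f\<close>, apart from
  \<open>z\<close> and the parameters; the first summand in the numerator is the Schwarz--Pick bound.
\<close>

lemma norm_schwarzian_le:
  assumes \<alpha>: "- pi / 2 < \<alpha>" "\<alpha> < pi / 2" and \<beta>: "\<beta> < 1"
    and f: "f \<in> class_S \<alpha> \<beta>" and z: "norm z < 1"
  defines "k \<equiv> sqrt ((sin \<alpha>)\<^sup>2 + \<beta>\<^sup>2 * (cos \<alpha>)\<^sup>2)"
  obtains t where "0 \<le> t" "t \<le> 1"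
    "norm (schwarzian f z) \<le>
       2 * (1 - \<beta>) * cos \<alpha> * ((1 - t\<^sup>2) / (1 - (norm z)\<^sup>2) + k * t\<^sup>2) / (1 - norm z * t)\<^sup>2"
proof -
  define C where "C = 2 * (1 - \<beta>) * cos \<alpha>"
  define c where "c = of_real C * cis (- \<alpha>)"
  define T where "T = (\<lambda>z. deriv (deriv f) z / deriv f z)"
  define \<phi> where "\<phi> = (\<lambda>z. T z / (c + z * T z))"
  have cospos: "0 < cos \<alpha>"
    using \<alpha> by (intro cos_gt_zero_pi) auto
  then have Cpos: "0 < C"
    using \<beta> by (simp add: C_def)
  have normc: "norm c = C"
    using Cpos by (simp add: c_def norm_mult)
  then have c0: "c \<noteq> 0"
    using Cpos by auto
  have fhol: "f holomorphic_on ball 0 1" and f'nz: "\<And>z. z \<in> ball 0 1 \<Longrightarrow> deriv f z \<noteq> 0"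
    and re: "\<And>z. z \<in> ball 0 1 \<Longrightarrow> Re (exp (\<i> * of_real \<alpha>) * (1 + z * T z)) > \<beta> * cos \<alpha>"
    using f by (auto simp: class_S_def locally_univalent_def T_def)
  have Thol: "T holomorphic_on ball 0 1"
    unfolding T_def using f'nz by (intro holomorphic_intros holomorphic_deriv fhol) auto
  have less: "norm (x * T x) < norm (c + x * T x)" if "norm x < 1" for x
  proof -
    have "Re (cnj c * (x * T x)) = C * Re (cis \<alpha> * (x * T x))"
      by (simp add: c_def cis_cnj mult.assoc)
    moreover have "\<beta> * cos \<alpha> < cos \<alpha> + Re (cis \<alpha> * (x * T x))"
      using re[of x] that
      by (simp only: cis_conv_exp[symmetric] distrib_left mult_1_right plus_complex.sel cis.sel
          mem_ball_0)
    then have "Re (cis \<alpha> * (x * T x)) > - (C / 2)"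
      by (simp add: C_def field_simps del: times_complex.sel)
    then have "C * Re (cis \<alpha> * (x * T x)) > C * - (C / 2)"
      using Cpos by (intro mult_strict_left_mono) auto
    ultimately show ?thesis
      unfolding norm_less_norm_add_iff normc by (simp add: power2_eq_square)
  qed
  have nz: "c + x * T x \<noteq> 0" if "norm x < 1" for x
    using less[OF that] by auto
  have \<phi>hol: "\<phi> holomorphic_on ball 0 1"
    unfolding \<phi>_def using nz by (intro holomorphic_intros Thol) auto
  have "norm (x * \<phi> x) < 1" if "norm x < 1" for x
    using less[OF that] nz[OF that] by (simp add: \<phi>_def norm_mult norm_divide)
  then have \<phi>bd: "norm (\<phi> x) \<le> 1" if "norm x < 1" for x
    using norm_le_1_if_norm_ident_mult_less_1[OF \<phi>hol] that by blast
  define t where "t = norm (\<phi> z)"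
  have t: "0 \<le> t" "t \<le> 1"
    using \<phi>bd[OF z] by (simp_all add: t_def)
  have SP: "norm (deriv \<phi> z) \<le> (1 - t\<^sup>2) / (1 - (norm z)\<^sup>2)"
    unfolding t_def by (rule Schwarz_Pick_deriv[OF \<phi>hol \<phi>bd z])
  have "C / 2 = (1 - \<beta>) * cos \<alpha>"
    by (simp add: C_def)
  moreover have "c / 2 = of_real (C / 2) * cis (- \<alpha>)"
    by (simp add: c_def)
  ultimately have k: "norm (1 - c / 2) = k"
    using norm_class_S_constant[of \<beta> \<alpha>] by (simp only: k_def)
  have "(T has_field_derivative deriv T z) (at z)"
    using Thol z by (intro holomorphic_derivI[where S = "ball 0 1"]) auto
  from riccati_of_quotient[OF this nz[OF z] c0]
  have S: "schwarzian f z = c * (deriv \<phi> z + (1 - c / 2) * (\<phi> z)\<^sup>2) / (1 - z * \<phi> z)\<^sup>2"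
    by (simp add: schwarzian_def T_def \<phi>_def)
  have "norm (deriv \<phi> z + (1 - c / 2) * (\<phi> z)\<^sup>2) \<le> norm (deriv \<phi> z) + k * t\<^sup>2"
    using norm_triangle_ineq[of "deriv \<phi> z" "(1 - c / 2) * (\<phi> z)\<^sup>2"]
    by (simp add: norm_mult norm_power k t_def)
  also have "\<dots> \<le> (1 - t\<^sup>2) / (1 - (norm z)\<^sup>2) + k * t\<^sup>2"
    using SP by simp
  finally have num: "norm (c * (deriv \<phi> z + (1 - c / 2) * (\<phi> z)\<^sup>2))
      \<le> C * ((1 - t\<^sup>2) / (1 - (norm z)\<^sup>2) + k * t\<^sup>2)"
    unfolding norm_mult normc using Cpos by (intro mult_left_mono) auto
  have rt: "norm z * t < 1"
    using mult_left_le[of t "norm z"] t z by simp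
  have "1 - norm z * t \<le> norm (1 - z * \<phi> z)"
    using norm_triangle_ineq2[of 1 "z * \<phi> z"] by (simp add: norm_mult t_def)
  then have den: "(1 - norm z * t)\<^sup>2 \<le> (norm (1 - z * \<phi> z))\<^sup>2"
    using rt by (intro power_mono) auto
  have "norm (schwarzian f z)
      \<le> C * ((1 - t\<^sup>2) / (1 - (norm z)\<^sup>2) + k * t\<^sup>2) / (1 - norm z * t)\<^sup>2"
    unfolding S norm_divide norm_power
    using rt num den order_trans[OF norm_ge_zero num] by (intro frac_le) auto
  then show thesis
    using that[OF t] by (simp add: C_def)
qed

section \<open>Maximising over the modulus of the bounded function\<close>

lemma schwarz_pick_term_eq:
  fixes r t k :: real
  assumes r: "0 \<le> r" "r < 1"
  shows "(1 - t\<^sup>2) / (1 - r\<^sup>2) + k * t\<^sup>2 = (1 - (1 - k * (1 - r\<^sup>2)) * t\<^sup>2) / (1 - r\<^sup>2)"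
proof -
  have "0 < 1 - r\<^sup>2"
    using r by (simp add: abs_square_less_1)
  then show ?thesis
    by (simp add: field_simps)
qed

text \<open>
  The right-hand side is the value at the critical point \<open>t = r / a\<close>; after clearing denominators the
  two sides differ by \<open>(r - a t)\<^sup>2\<close>. The bound is therefore valid also when \<open>r / a > 1\<close>, but then the
  maximum over \<open>t \<le> 1\<close> is smaller, namely the one in the lemma that follows.
\<close>

lemma quotient_le_critical_value:
  fixes r t a :: real
  assumes a: "r\<^sup>2 < a" and rt: "r * t < 1"
  shows "(1 - a * t\<^sup>2) / (1 - r * t)\<^sup>2 \<le> a / (a - r\<^sup>2)"
proof -
  have "a * (1 - r * t)\<^sup>2 - (1 - a * t\<^sup>2) * (a - r\<^sup>2) = (r - a * t)\<^sup>2"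
    by (simp only: power2_eq_square) algebra
  then have "(1 - a * t\<^sup>2) * (a - r\<^sup>2) \<le> a * (1 - r * t)\<^sup>2"
    using zero_le_power2[of "r - a * t"] by linarith
  then show ?thesis
    using assms by (simp add: divide_simps)
qed

text \<open>
  After clearing denominators the claim is affine in \<open>a\<close>, so it suffices to check \<open>a = 0\<close>, where it is
  \<open>1 - r \<le> 1 - r t\<close>, and \<open>a = r\<close>, where the difference of the two sides is \<open>r (1 - r) (1 - t)\<^sup>2\<close>.
\<close>

lemma quotient_le_endpoint_value:
  fixes r t a :: real
  assumes a: "0 \<le> a" "a \<le> r" and r: "r < 1" and t: "t \<le> 1"
  shows "(1 - a * t\<^sup>2) / (1 - r * t)\<^sup>2 \<le> (1 - a) / (1 - r)\<^sup>2"
proof (cases "r = 0")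
  case True
  then show ?thesis using a by simp
next
  case False
  then have rpos: "0 < r" using a by simp
  have rt: "1 - r \<le> 1 - r * t"
    using mult_left_mono[OF t, of r] rpos by simp
  have at0: "0 \<le> (1 - r * t)\<^sup>2 - (1 - r)\<^sup>2"
    using power_mono[OF rt, of 2] r by simp
  have "r * ((1 - a) * (1 - r * t)\<^sup>2 - (1 - a * t\<^sup>2) * (1 - r)\<^sup>2)
      = (r - a) * ((1 - r * t)\<^sup>2 - (1 - r)\<^sup>2) + a * (r * (1 - r) * (1 - t)\<^sup>2)"
    by (simp only: power2_eq_square) algebra
  also have "\<dots> \<ge> 0"
    using a r rpos at0 by (intro add_nonneg_nonneg mult_nonneg_nonneg) auto
  finally have "0 \<le> (1 - a) * (1 - r * t)\<^sup>2 - (1 - a * t\<^sup>2) * (1 - r)\<^sup>2"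
    using rpos by (simp add: zero_le_mult_iff)
  then show ?thesis
    using r rt by (simp add: divide_simps)
qed

text \<open>
  In the next two lemmas \<open>a = 1 - k (1 - r\<^sup>2)\<close>. The condition \<open>r\<^sup>2 < a\<close> always holds, because
  \<open>a - r\<^sup>2 = (1 - r\<^sup>2) (1 - k)\<close>, and \<open>a \<le> r\<close> is equivalent to \<open>1 \<le> k (1 + r)\<close>, because
  \<open>r - a = (1 - r) (k (1 + r) - 1)\<close>.
\<close>

lemma schwarz_pick_bound_le_interior:
  fixes r t k C :: real
  assumes r: "0 \<le> r" "r < 1" and t: "t \<le> 1" and k: "k < 1" and C: "0 \<le> C"
  shows "C * ((1 - t\<^sup>2) / (1 - r\<^sup>2) + k * t\<^sup>2) / (1 - r * t)\<^sup>2
       \<le> C * (1 - (1 - r\<^sup>2) * k) / ((1 - r\<^sup>2)\<^sup>2 * (1 - k))"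
proof -
  define a where "a = 1 - k * (1 - r\<^sup>2)"
  have r2: "0 < 1 - r\<^sup>2"
    using r by (simp add: abs_square_less_1)
  have ar: "a - r\<^sup>2 = (1 - r\<^sup>2) * (1 - k)"
    unfolding a_def by algebra
  have "0 < (1 - r\<^sup>2) * (1 - k)"
    using r2 k by simp
  then have "r\<^sup>2 < a"
    using ar by linarith
  moreover have "r * t < 1"
    using mult_left_le[OF t r(1)] r by linarith
  ultimately have "(1 - a * t\<^sup>2) / (1 - r * t)\<^sup>2 \<le> a / (a - r\<^sup>2)"
    by (rule quotient_le_critical_value)
  then have "C / (1 - r\<^sup>2) * ((1 - a * t\<^sup>2) / (1 - r * t)\<^sup>2) \<le> C / (1 - r\<^sup>2) * (a / (a - r\<^sup>2))"
    using C r2 by (intro mult_left_mono) auto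
  then show ?thesis
    unfolding schwarz_pick_term_eq[OF r] ar
    by (simp add: a_def power2_eq_square mult_ac)
qed

lemma schwarz_pick_bound_le_boundary:
  fixes r t k C :: real
  assumes r: "0 \<le> r" "r < 1" and t: "t \<le> 1" and k: "k < 1" "1 \<le> k * (1 + r)" and C: "0 \<le> C"
  shows "C * ((1 - t\<^sup>2) / (1 - r\<^sup>2) + k * t\<^sup>2) / (1 - r * t)\<^sup>2 \<le> C * k / (1 - r)\<^sup>2"
proof -
  define a where "a = 1 - k * (1 - r\<^sup>2)"
  have r2: "0 < 1 - r\<^sup>2" "1 - r\<^sup>2 \<le> 1"
    using r by (simp_all add: abs_square_less_1)
  have "k * (1 - r\<^sup>2) \<le> 1 - r\<^sup>2"
    using mult_right_mono[of k 1 "1 - r\<^sup>2"] k r2 by simp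
  then have a0: "0 \<le> a"
    using r2 unfolding a_def by linarith
  have "r - a = (1 - r) * (k * (1 + r) - 1)"
    unfolding a_def by algebra
  moreover have "0 \<le> (1 - r) * (k * (1 + r) - 1)"
    using r k by (intro mult_nonneg_nonneg) auto
  ultimately have "a \<le> r"
    by linarith
  from quotient_le_endpoint_value[OF a0 this r(2) t]
  have "C / (1 - r\<^sup>2) * ((1 - a * t\<^sup>2) / (1 - r * t)\<^sup>2) \<le> C / (1 - r\<^sup>2) * ((1 - a) / (1 - r)\<^sup>2)"
    using C r2 by (intro mult_left_mono) auto
  moreover have "C / (1 - r\<^sup>2) * ((1 - a) / (1 - r)\<^sup>2) = C * k / (1 - r)\<^sup>2"
    using r2 by (simp add: a_def)
  ultimately show ?thesis
    unfolding schwarz_pick_term_eq[OF r] using r2 by (simp add: a_def mult_ac)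
qed

section \<open>The estimate of the Schwarzian derivative\<close>

lemma class_S_constant_less_1:
  assumes "- pi / 2 < \<alpha>" "\<alpha> < pi / 2" "0 \<le> \<beta>" "\<beta> < (1::real)"
  shows "sqrt ((sin \<alpha>)\<^sup>2 + \<beta>\<^sup>2 * (cos \<alpha>)\<^sup>2) < 1"
proof -
  have "0 < cos \<alpha>"
    using assms by (intro cos_gt_zero_pi) auto
  moreover have "\<beta>\<^sup>2 < 1"
    using assms by (simp add: abs_square_less_1)
  ultimately have "\<beta>\<^sup>2 * (cos \<alpha>)\<^sup>2 < 1 * (cos \<alpha>)\<^sup>2"
    by (intro mult_strict_right_mono) auto
  then have "(sin \<alpha>)\<^sup>2 + \<beta>\<^sup>2 * (cos \<alpha>)\<^sup>2 < 1"
    using sin_cos_squared_add[of \<alpha>] by linarith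
  then show ?thesis
    by simp
qed

theorem theorem2p1:
  fixes \<alpha> \<beta> :: real and f :: "complex \<Rightarrow> complex"
  assumes "- pi / 2 < \<alpha>" and "\<alpha> < pi / 2"
    and "0 \<le> \<beta>" and "\<beta> < 1"
    and "f \<in> class_S \<alpha> \<beta>"
  shows "let k = sqrt ((sin \<alpha>)\<^sup>2 + \<beta>\<^sup>2 * (cos \<alpha>)\<^sup>2);
             lam = (1 - k) / k
         in
           ((sin \<alpha>)\<^sup>2 + \<beta>\<^sup>2 * (cos \<alpha>)\<^sup>2 \<le> 1 / 4 \<longrightarrow>
             (\<forall>z\<in>unit_disk.
                norm (schwarzian f z) \<le>
                  2 * (1 - \<beta>) * cos \<alpha> * (1 - (1 - (norm z)\<^sup>2) * k)
                    / ((1 - (norm z)\<^sup>2)\<^sup>2 * (1 - k)))) \<and>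
           ((sin \<alpha>)\<^sup>2 + \<beta>\<^sup>2 * (cos \<alpha>)\<^sup>2 > 1 / 4 \<longrightarrow>
             (\<forall>z\<in>unit_disk.
                norm (schwarzian f z) \<le>
                  (if norm z < lam
                   then 2 * (1 - \<beta>) * cos \<alpha> * (1 - (1 - (norm z)\<^sup>2) * k)
                          / ((1 - (norm z)\<^sup>2)\<^sup>2 * (1 - k))
                   else 2 * (1 - \<beta>) * cos \<alpha> * k / (1 - norm z)\<^sup>2)))"
proof -
  define k where "k = sqrt ((sin \<alpha>)\<^sup>2 + \<beta>\<^sup>2 * (cos \<alpha>)\<^sup>2)"
  define C where "C = 2 * (1 - \<beta>) * cos \<alpha>"
  have k1: "k < 1"
    unfolding k_def using assms by (intro class_S_constant_less_1) auto
  have "0 < cos \<alpha>"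
    using assms by (intro cos_gt_zero_pi) auto
  then have C0: "0 \<le> C"
    using assms by (simp add: C_def)
  have interior: "norm (schwarzian f z) \<le> C * (1 - (1 - (norm z)\<^sup>2) * k) / ((1 - (norm z)\<^sup>2)\<^sup>2 * (1 - k))"
    if z: "norm z < 1" for z
  proof -
    from norm_schwarzian_le[OF assms(1,2,4,5) z, folded k_def C_def] obtain t where t: "t \<le> 1"
      and S: "norm (schwarzian f z)
        \<le> C * ((1 - t\<^sup>2) / (1 - (norm z)\<^sup>2) + k * t\<^sup>2) / (1 - norm z * t)\<^sup>2"
      by metis
    note S
    also note schwarz_pick_bound_le_interior[OF norm_ge_zero z t k1 C0]
    finally show ?thesis .
  qed
  have boundary: "norm (schwarzian f z) \<le> C * k / (1 - norm z)\<^sup>2"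
    if z: "norm z < 1" "1 \<le> k * (1 + norm z)" for z
  proof -
    from norm_schwarzian_le[OF assms(1,2,4,5) z(1), folded k_def C_def] obtain t where t: "t \<le> 1"
      and S: "norm (schwarzian f z)
        \<le> C * ((1 - t\<^sup>2) / (1 - (norm z)\<^sup>2) + k * t\<^sup>2) / (1 - norm z * t)\<^sup>2"
      by metis
    note S
    also note schwarz_pick_bound_le_boundary[OF norm_ge_zero z(1) t k1 z(2) C0]
    finally show ?thesis .
  qed
  have beyond: "1 \<le> k * (1 + norm z)"
    if "(sin \<alpha>)\<^sup>2 + \<beta>\<^sup>2 * (cos \<alpha>)\<^sup>2 > 1 / 4" and "\<not> norm z < (1 - k) / k" for z :: complex
  proof -
    \<comment> \<open>If \<open>k\<close> were zero, \<open>(1 - k) / k\<close> would take the default value zero and carry no information.\<close>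
    have "0 < k"
      unfolding k_def using that(1) by (intro real_sqrt_gt_zero) linarith
    then show ?thesis
      using that(2) by (simp add: field_simps)
  qed
  show ?thesis
    unfolding Let_def k_def[symmetric] C_def[symmetric]
    using interior boundary beyond by auto
qed

end
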